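(* Let $G$ be a locally compact Abelian group, $\omega$ a weight function on $G$, and $\mathfrak D=\{(x,x^{-1}):x\in G\}$, a closed subgroup of $G\times G$ (hence a locally compact Abelian group), equipped with the restriction of the weight $\omega^\otimes(x,y)=\omega(x)\omega(y)$. Then $L^1(G,\omega^* )$ is weakly amenable if and only if $L^1(\mathfrak D,\omega^\otimes|_{\mathfrak D})$ is weakly amenable.
   Context: A weight function on $G$ is a continuous $\omega:G\to[1,\infty)$ with $\omega(xy)\le\omega(x)\omega(y)$ and $\omega(e)=1$; $\omega^*(x)=\omega(x)\omega(x^{-1})$. $L^1(G,\omega)$ is the Banach algebra under convolution of Borel $f$ with $\int|f|\omega\,dx<\infty$ (Haar measure). A Banach algebra $A$ is weakly amenable if every bounded derivation $D:A\to A^*$ is inner. *)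

theory Defs
  imports "HOL-Analysis.Analysis"
begin

text \<open>Abelian groups are written additively: the ambient type 'a carries an abelian group
structure and a Hausdorff topology; a (locally compact abelian) group is a carrier set S
of that type with the subspace topology.\<close>

definition lca_group_on :: "('a::{t2_space, ab_group_add}) set \<Rightarrow> bool" where
  "lca_group_on S \<longleftrightarrow>
     0 \<in> S \<and> (\<forall>x\<in>S. \<forall>y\<in>S. x + y \<in> S) \<and> (\<forall>x\<in>S. - x \<in> S) \<and>
     continuous_on (S \<times> S) (\<lambda>(x, y). x + y) \<and> continuous_on S uminus \<and>
     locally_compact_space (top_of_set S)"

definition haar_measure_on :: "('a::{t2_space, ab_group_add}) set \<Rightarrow> 'a measure \<Rightarrow> bool" where
  "haar_measure_on S \<mu> \<longleftrightarrow>
     space \<mu> = S \<and> sets \<mu> = sets (restrict_space borel S) \<and>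
     (\<forall>a\<in>S. \<forall>A\<in>sets \<mu>. emeasure \<mu> ((\<lambda>x. a + x) ` A) = emeasure \<mu> A) \<and>
     (\<forall>K. compact K \<and> K \<subseteq> S \<longrightarrow> emeasure \<mu> K < \<infinity>) \<and>
     (\<forall>U. openin (top_of_set S) U \<and> U \<noteq> {} \<longrightarrow> emeasure \<mu> U > 0) \<and>
     (\<forall>A\<in>sets \<mu>. emeasure \<mu> A = (INF U\<in>{U. openin (top_of_set S) U \<and> A \<subseteq> U}. emeasure \<mu> U)) \<and>
     (\<forall>U. openin (top_of_set S) U \<longrightarrow>
          emeasure \<mu> U = (SUP K\<in>{K. compact K \<and> K \<subseteq> U}. emeasure \<mu> K))"

definition weight_on :: "('a::{topological_space, ab_group_add}) set \<Rightarrow> ('a \<Rightarrow> real) \<Rightarrow> bool" where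
  "weight_on S \<omega> \<longleftrightarrow>
     continuous_on S \<omega> \<and> (\<forall>x\<in>S. 1 \<le> \<omega> x) \<and>
     (\<forall>x\<in>S. \<forall>y\<in>S. \<omega> (x + y) \<le> \<omega> x * \<omega> y) \<and> \<omega> 0 = 1"

definition weight_star :: "('a::ab_group_add \<Rightarrow> real) \<Rightarrow> 'a \<Rightarrow> real" where
  "weight_star \<omega> x = \<omega> x * \<omega> (- x)"

definition weight_tensor :: "('a \<Rightarrow> real) \<Rightarrow> 'a \<times> 'a \<Rightarrow> real" where
  "weight_tensor \<omega> p = \<omega> (fst p) * \<omega> (snd p)"

definition anti_diag :: "('a::ab_group_add \<times> 'a) set" where
  "anti_diag = {(x, - x) | x. True}"

text \<open>Elements of L^1(G, omega) (complex scalars), represented by functions; the seminorm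
identifies functions equal almost everywhere.\<close>
definition L1w :: "'a measure \<Rightarrow> ('a \<Rightarrow> real) \<Rightarrow> ('a \<Rightarrow> complex) set" where
  "L1w \<mu> \<omega> = {f. f \<in> borel_measurable \<mu> \<and> integrable \<mu> (\<lambda>x. cmod (f x) * \<omega> x)}"

definition L1w_norm :: "'a measure \<Rightarrow> ('a \<Rightarrow> real) \<Rightarrow> ('a \<Rightarrow> complex) \<Rightarrow> real" where
  "L1w_norm \<mu> \<omega> f = (\<integral>x. cmod (f x) * \<omega> x \<partial>\<mu>)"

definition conv :: "('a::ab_group_add) measure \<Rightarrow> ('a \<Rightarrow> complex) \<Rightarrow> ('a \<Rightarrow> complex) \<Rightarrow> 'a \<Rightarrow> complex" where
  "conv \<mu> f g x = (\<integral>y. f y * g (x - y) \<partial>\<mu>)"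

definition bounded_functional :: "'a measure \<Rightarrow> ('a \<Rightarrow> real) \<Rightarrow> (('a \<Rightarrow> complex) \<Rightarrow> complex) \<Rightarrow> bool" where
  "bounded_functional \<mu> \<omega> \<phi> \<longleftrightarrow>
     (\<forall>f\<in>L1w \<mu> \<omega>. \<forall>g\<in>L1w \<mu> \<omega>. \<phi> (\<lambda>x. f x + g x) = \<phi> f + \<phi> g) \<and>
     (\<forall>f\<in>L1w \<mu> \<omega>. \<forall>c. \<phi> (\<lambda>x. c * f x) = c * \<phi> f) \<and>
     (\<exists>C. \<forall>f\<in>L1w \<mu> \<omega>. cmod (\<phi> f) \<le> C * L1w_norm \<mu> \<omega> f)"

text \<open>Bounded derivations D : A \<rightarrow> A*, with the dual module actions
  (f\<cdot>\<phi>)(h) = \<phi>(h * f) and (\<phi>\<cdot>f)(h) = \<phi>(f * h).\<close>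
definition bounded_derivation :: "('a::ab_group_add) measure \<Rightarrow> ('a \<Rightarrow> real) \<Rightarrow>
    (('a \<Rightarrow> complex) \<Rightarrow> ('a \<Rightarrow> complex) \<Rightarrow> complex) \<Rightarrow> bool" where
  "bounded_derivation \<mu> \<omega> D \<longleftrightarrow>
     (\<forall>f\<in>L1w \<mu> \<omega>. bounded_functional \<mu> \<omega> (D f)) \<and>
     (\<forall>f\<in>L1w \<mu> \<omega>. \<forall>g\<in>L1w \<mu> \<omega>. \<forall>h\<in>L1w \<mu> \<omega>. D (\<lambda>x. f x + g x) h = D f h + D g h) \<and>
     (\<forall>f\<in>L1w \<mu> \<omega>. \<forall>c. \<forall>h\<in>L1w \<mu> \<omega>. D (\<lambda>x. c * f x) h = c * D f h) \<and>
     (\<exists>C. \<forall>f\<in>L1w \<mu> \<omega>. \<forall>h\<in>L1w \<mu> \<omega>.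
          cmod (D f h) \<le> C * L1w_norm \<mu> \<omega> f * L1w_norm \<mu> \<omega> h) \<and>
     (\<forall>f\<in>L1w \<mu> \<omega>. \<forall>g\<in>L1w \<mu> \<omega>. \<forall>h\<in>L1w \<mu> \<omega>.
          D (conv \<mu> f g) h = D g (conv \<mu> h f) + D f (conv \<mu> g h))"

definition inner_derivation :: "('a::ab_group_add) measure \<Rightarrow> ('a \<Rightarrow> real) \<Rightarrow>
    (('a \<Rightarrow> complex) \<Rightarrow> ('a \<Rightarrow> complex) \<Rightarrow> complex) \<Rightarrow> bool" where
  "inner_derivation \<mu> \<omega> D \<longleftrightarrow>
     (\<exists>\<phi>. bounded_functional \<mu> \<omega> \<phi> \<and>
        (\<forall>f\<in>L1w \<mu> \<omega>. \<forall>h\<in>L1w \<mu> \<omega>. D f h = \<phi> (conv \<mu> h f) - \<phi> (conv \<mu> f h)))"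

definition weakly_amenable_L1 :: "('a::ab_group_add) measure \<Rightarrow> ('a \<Rightarrow> real) \<Rightarrow> bool" where
  "weakly_amenable_L1 \<mu> \<omega> \<longleftrightarrow>
     (\<forall>D. bounded_derivation \<mu> \<omega> D \<longrightarrow> inner_derivation \<mu> \<omega> D)"

end

theory Submission
  imports Defs
begin

text \<open>The map x \<mapsto> (x, -x) is an isomorphism of topological groups from G onto the
antidiagonal which carries the tensor weight to the starred weight, so by uniqueness of Haar
measure \<nu> is c times the transported \<mu>. Then F \<mapsto> c F(x, -x) is an isometric algebra
isomorphism between the two Beurling algebras, and derivations and functionals are pulled back
along it and its inverse.

Uniqueness of Haar measure rests on the identity
\<mu>(f) \<nu>(g) = \<mu>(x \<mapsto> g(-x)) \<nu>(f) for compactly supported continuous f and g. The group need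
not be second countable or sigma-compact, so Borel sets of G \<times> G may fail to be measurable for the
product sigma-algebra; Stone-Weierstrass shows that compactly supported continuous functions are
measurable nevertheless, and so Fubini's theorem applies to them.\<close>

subsection \<open>Uniqueness of Haar measure\<close>

text \<open>By Stone-Weierstrass, \<open>F\<close> is a uniform limit on \<open>K \<times> L\<close>
  of functions built by sums and products from continuous functions of one coordinate. These are
  measurable for the product sigma-algebra, and measurability survives the pointwise limit.\<close>

lemma borel_measurable_pair_compact_support:
  fixes F :: "'a::t2_space \<times> 'b::t2_space \<Rightarrow> real"
  assumes sepa: "\<And>x y::'a. x \<noteq> y \<Longrightarrow> \<exists>u::'a \<Rightarrow> real. continuous_on UNIV u \<and> u x \<noteq> u y"
    and sepb: "\<And>x y::'b. x \<noteq> y \<Longrightarrow> \<exists>u::'b \<Rightarrow> real. continuous_on UNIV u \<and> u x \<noteq> u y"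
    and K: "compact K" and L: "compact L"
    and cont: "continuous_on (K \<times> L) F"
    and supp: "\<And>p. p \<notin> K \<times> L \<Longrightarrow> F p = 0"
  shows "F \<in> borel_measurable (borel \<Otimes>\<^sub>M borel)"
proof -
  \<comment> \<open>The class carries two properties at once: continuity, which Stone-Weierstrass
    requires, and product measurability, which is the property to be passed on to
    \<open>F\<close>.\<close>
  let ?P = "\<lambda>g::'a \<times> 'b \<Rightarrow> real. continuous_on UNIV g \<and> g \<in> borel_measurable (borel \<Otimes>\<^sub>M borel)"
  have fst: "?P (\<lambda>p. u (fst p))" if "continuous_on UNIV u" for u
  proof -
    have [measurable]: "u \<in> borel_measurable borel"
      using that by (rule borel_measurable_continuous_onI)
    show ?thesis
      using continuous_on_compose2[OF that, of UNIV fst] by (simp add: continuous_on_fst)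
  qed
  have snd: "?P (\<lambda>p. u (snd p))" if "continuous_on UNIV u" for u
  proof -
    have [measurable]: "u \<in> borel_measurable borel"
      using that by (rule borel_measurable_continuous_onI)
    show ?thesis
      using continuous_on_compose2[OF that, of UNIV snd] by (simp add: continuous_on_snd)
  qed
  have approx: "\<exists>g. ?P g \<and> (\<forall>p\<in>K \<times> L. \<bar>F p - g p\<bar> < e)" if "0 < e" for e
  proof (rule Stone_Weierstrass_HOL[where P = ?P])
    show "compact (K \<times> L)" using K L by (rule compact_Times)
    show "\<exists>g. ?P g \<and> g p \<noteq> g q" if "p \<in> K \<times> L \<and> q \<in> K \<times> L \<and> p \<noteq> q" for p q
    proof (cases "fst p = fst q")
      case True
      then have "snd p \<noteq> snd q" using that by (auto simp: prod_eq_iff)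
      then show ?thesis using sepb snd by meson
    next
      case False
      then show ?thesis using sepa fst by meson
    qed
  qed (use cont that in \<open>auto intro: continuous_on_subset continuous_on_add continuous_on_mult\<close>)
  define g where "g = (\<lambda>n::nat. SOME g. ?P g \<and> (\<forall>p\<in>K \<times> L. \<bar>F p - g p\<bar> < 1 / Suc n))"
  have g: "?P (g n) \<and> (\<forall>p\<in>K \<times> L. \<bar>F p - g n p\<bar> < 1 / Suc n)" for n
    unfolding g_def by (rule someI_ex[OF approx]) simp
  have [measurable]: "K \<times> L \<in> sets (borel \<Otimes>\<^sub>M borel)"
    using K L by (intro pair_measureI) (auto intro: borel_closed compact_imp_closed)
  show ?thesis
  proof (rule borel_measurable_LIMSEQ_real)
    \<comment> \<open>The approximants are cut off by the indicator because nothing controls them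
      outside \<open>K \<times> L\<close>, where \<open>F\<close> vanishes.\<close>
    show "(\<lambda>p. indicator (K \<times> L) p * g n p) \<in> borel_measurable (borel \<Otimes>\<^sub>M borel)" for n
      using g[of n] by (intro borel_measurable_times borel_measurable_indicator) auto
    show "(\<lambda>n. indicator (K \<times> L) p * g n p) \<longlonglongrightarrow> F p" for p
    proof (cases "p \<in> K \<times> L")
      case True
      have "(\<lambda>n. g n p - F p) \<longlonglongrightarrow> 0"
      proof (rule Lim_null_comparison)
        show "\<forall>\<^sub>F n in sequentially. norm (g n p - F p) \<le> 1 / Suc n"
          using g True by (intro always_eventually) (auto simp: abs_minus_commute less_imp_le)
        show "(\<lambda>n. 1 / real (Suc n)) \<longlonglongrightarrow> 0"
          by (rule LIMSEQ_inverse_real_of_nat[unfolded inverse_eq_divide])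
      qed
      then show ?thesis using True by (simp add: LIM_zero_iff)
    qed (simp add: supp)
  qed
qed

text \<open>The measures may fail to be sigma-finite. Restricted to \<open>K\<close> and
  \<open>L\<close> they are finite, and since the integrand vanishes elsewhere, no integral changes.
  Fubini's theorem is applied to the restrictions.\<close>

lemma nn_integral_swap_compact_support:
  fixes F :: "'a::t2_space \<Rightarrow> 'b::t2_space \<Rightarrow> real"
  assumes sepa: "\<And>x y::'a. x \<noteq> y \<Longrightarrow> \<exists>u::'a \<Rightarrow> real. continuous_on UNIV u \<and> u x \<noteq> u y"
    and sepb: "\<And>x y::'b. x \<noteq> y \<Longrightarrow> \<exists>u::'b \<Rightarrow> real. continuous_on UNIV u \<and> u x \<noteq> u y"
    and K: "compact K" and L: "compact L"
    and cont: "continuous_on UNIV (\<lambda>(x, y). F x y)"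
    and supp: "\<And>x y. F x y \<noteq> 0 \<Longrightarrow> x \<in> K \<and> y \<in> L"
    and [measurable_cong]: "sets \<mu> = sets borel" "sets \<nu> = sets borel"
    and fin: "emeasure \<mu> K < \<infinity>" "emeasure \<nu> L < \<infinity>"
  shows "(\<integral>\<^sup>+x. \<integral>\<^sup>+y. ennreal (F x y) \<partial>\<nu> \<partial>\<mu>) = (\<integral>\<^sup>+y. \<integral>\<^sup>+x. ennreal (F x y) \<partial>\<mu> \<partial>\<nu>)"
proof -
  have F[measurable]: "(\<lambda>(x, y). F x y) \<in> borel_measurable (borel \<Otimes>\<^sub>M borel)"
    using sepa sepb K L
  proof (rule borel_measurable_pair_compact_support)
    show "continuous_on (K \<times> L) (\<lambda>(x, y). F x y)"
      using cont by (rule continuous_on_subset) simp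
  qed (use supp in auto)
  have [measurable]: "K \<in> sets borel" "L \<in> sets borel"
    using K L by (auto intro: borel_closed compact_imp_closed)
  have F0: "F x y = 0" if "x \<notin> K \<or> y \<notin> L" for x y
    using supp that by metis
  define \<mu>' where "\<mu>' = density \<mu> (indicator K)"
  define \<nu>' where "\<nu>' = density \<nu> (indicator L)"
  have [measurable_cong]: "sets \<mu>' = sets borel" "sets \<nu>' = sets borel"
    by (simp_all add: \<mu>'_def \<nu>'_def assms)
  have "space \<mu> = UNIV" "space \<nu> = UNIV"
    using sets_eq_imp_space_eq[of \<mu> borel] sets_eq_imp_space_eq[of \<nu> borel] assms by auto
  then have "finite_measure \<mu>'" "finite_measure \<nu>'"
    using fin by (auto intro!: finite_measureI simp: \<mu>'_def \<nu>'_def emeasure_density)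
  then interpret pair_sigma_finite \<mu>' \<nu>'
    by (simp add: pair_sigma_finite_def finite_measure.axioms)
  have \<mu>': "(\<integral>\<^sup>+x. h x \<partial>\<mu>') = (\<integral>\<^sup>+x. h x \<partial>\<mu>)"
    if [measurable]: "h \<in> borel_measurable borel" and "\<And>x. x \<notin> K \<Longrightarrow> h x = 0" for h
  proof -
    have "(\<integral>\<^sup>+x. h x \<partial>\<mu>') = (\<integral>\<^sup>+x. indicator K x * h x \<partial>\<mu>)"
      unfolding \<mu>'_def by (rule nn_integral_density) measurable
    also have "\<dots> = (\<integral>\<^sup>+x. h x \<partial>\<mu>)"
      using that(2) by (intro nn_integral_cong) (auto simp: indicator_def)
    finally show ?thesis .
  qed
  have \<nu>': "(\<integral>\<^sup>+y. h y \<partial>\<nu>') = (\<integral>\<^sup>+y. h y \<partial>\<nu>)"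
    if [measurable]: "h \<in> borel_measurable borel" and "\<And>y. y \<notin> L \<Longrightarrow> h y = 0" for h
  proof -
    have "(\<integral>\<^sup>+y. h y \<partial>\<nu>') = (\<integral>\<^sup>+y. indicator L y * h y \<partial>\<nu>)"
      unfolding \<nu>'_def by (rule nn_integral_density) measurable
    also have "\<dots> = (\<integral>\<^sup>+y. h y \<partial>\<nu>)"
      using that(2) by (intro nn_integral_cong) (auto simp: indicator_def)
    finally show ?thesis .
  qed
  have slice: "(\<integral>\<^sup>+y. F x y \<partial>\<nu>') = (\<integral>\<^sup>+y. F x y \<partial>\<nu>)"
      "(\<integral>\<^sup>+x. F x y \<partial>\<mu>') = (\<integral>\<^sup>+x. F x y \<partial>\<mu>)" for x y
    by (auto intro!: \<mu>' \<nu>' simp: F0)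
  have "(\<integral>\<^sup>+x. \<integral>\<^sup>+y. F x y \<partial>\<nu> \<partial>\<mu>) = (\<integral>\<^sup>+x. \<integral>\<^sup>+y. F x y \<partial>\<nu>' \<partial>\<mu>')"
    \<comment> \<open>The inner integral is first rewritten over the finite measure
      \<open>\<nu>'\<close>, which makes it measurable in \<open>x\<close>; only then can
      \<open>\<mu>\<close> be exchanged for \<open>\<mu>'\<close>.\<close>
    unfolding slice(1)[symmetric]
  proof (rule \<mu>'[symmetric])
    show "(\<integral>\<^sup>+y. F x y \<partial>\<nu>') = 0" if "x \<notin> K" for x
      using that by (simp add: F0)
  qed measurable
  also have "\<dots> = (\<integral>\<^sup>+y. \<integral>\<^sup>+x. F x y \<partial>\<mu>' \<partial>\<nu>')"
    by (rule Fubini'[symmetric]) measurable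
  also have "\<dots> = (\<integral>\<^sup>+y. \<integral>\<^sup>+x. F x y \<partial>\<mu> \<partial>\<nu>)"
    unfolding slice(2)[symmetric]
  proof (rule \<nu>')
    show "(\<integral>\<^sup>+x. F x y \<partial>\<mu>') = 0" if "y \<notin> L" for y
      using that by (simp add: F0)
  qed measurable
  finally show ?thesis .
qed

section \<open>Continuous functions on a locally compact abelian group\<close>

lemma lca_group_continuous_add:
  fixes f g :: "'b::topological_space \<Rightarrow> 'a::{t2_space, ab_group_add}"
  assumes "lca_group_on (UNIV :: 'a set)" "continuous_on S f" "continuous_on S g"
  shows "continuous_on S (\<lambda>x. f x + g x)"
proof -
  have "continuous_on UNIV (\<lambda>(x, y). x + y :: 'a)"
    using assms(1) by (simp add: lca_group_on_def)
  from continuous_on_compose2[OF this continuous_on_Pair[OF assms(2,3)]] show ?thesis by simp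
qed

lemma lca_group_continuous_minus:
  fixes f :: "'b::topological_space \<Rightarrow> 'a::{t2_space, ab_group_add}"
  assumes "lca_group_on (UNIV :: 'a set)" "continuous_on S f"
  shows "continuous_on S (\<lambda>x. - f x)"
proof -
  have "continuous_on UNIV (uminus :: 'a \<Rightarrow> 'a)"
    using assms(1) by (simp add: lca_group_on_def)
  from continuous_on_compose2[OF this assms(2)] show ?thesis by simp
qed

lemma lca_group_continuous_diff:
  fixes f g :: "'b::topological_space \<Rightarrow> 'a::{t2_space, ab_group_add}"
  assumes "lca_group_on (UNIV :: 'a set)" "continuous_on S f" "continuous_on S g"
  shows "continuous_on S (\<lambda>x. f x - g x)"
  using lca_group_continuous_add[OF assms(1,2) lca_group_continuous_minus[OF assms(1,3)]] by simp

lemmas lca_group_continuous =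
  lca_group_continuous_add lca_group_continuous_minus lca_group_continuous_diff

text \<open>A locally compact Hausdorff space is completely regular, so a compact set can be
  separated from a disjoint closed one. The closed set is the complement of
  \<open>V \<inter> U\<close>, where \<open>V\<close> is an open neighbourhood of \<open>K\<close>
  inside a compact \<open>C\<close>; thus \<open>f\<close> has compact support and also stays below
  the indicator of \<open>U\<close>.\<close>

lemma lca_group_Urysohn:
  fixes K U :: "'a::{t2_space, ab_group_add} set"
  assumes G: "lca_group_on (UNIV :: 'a set)" and K: "compact K" and U: "open U" "K \<subseteq> U"
  obtains f :: "'a \<Rightarrow> real" and C where "continuous_on UNIV f" "compact C"
    "\<And>x. f x \<in> {0..1}" "\<And>x. x \<in> K \<Longrightarrow> f x = 1" "\<And>x. x \<notin> C \<inter> U \<Longrightarrow> f x = 0"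
proof -
  have lc: "locally_compact_space (euclidean :: 'a topology)"
    using G by (simp add: lca_group_on_def)
  have haus: "Hausdorff_space (euclidean :: 'a topology)"
    unfolding Hausdorff_space_def disjnt_def by (simp, metis hausdorff)
  have cr: "completely_regular_space (euclidean :: 'a topology)"
    using lc haus by (intro locally_compact_regular_imp_completely_regular_space) auto
  obtain V C where VC: "open V" "compact C" "K \<subseteq> V" "V \<subseteq> C"
    using lc K locally_compact_space_compact_closed_compact[of "euclidean :: 'a topology"] haus
    by auto
  obtain f where f: "continuous_map euclidean (top_of_set {0..1::real}) f"
      "f ` (- (V \<inter> U)) \<subseteq> {0}" "f ` K \<subseteq> {1}"
  proof (rule Urysohn_completely_regular_compact_closed[of 0 1 euclidean K "- (V \<inter> U)"])
    show "closedin euclidean (- (V \<inter> U))" using VC U by (auto intro: closed_Compl)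
    show "disjnt K (- (V \<inter> U))" using VC U by (auto simp: disjnt_def)
  qed (use cr K in auto)
  show thesis
  proof (rule that[of f C])
    show "continuous_on UNIV f"
      using f(1) by (simp add: continuous_map_in_subtopology)
    show "f x \<in> {0..1}" for x
      using f(1) by (auto simp: continuous_map_in_subtopology)
    show "f x = 1" if "x \<in> K" for x using f(3) that by auto
    show "f x = 0" if "x \<notin> C \<inter> U" for x using f(2) VC(4) that by blast
  qed (use VC in auto)
qed

text \<open>Supplies the separation hypotheses of the Fubini lemma: a Urysohn function for the
  compact set \<open>{x}\<close> inside the complement of \<open>y\<close>.\<close>

lemma lca_group_separating:
  fixes x y :: "'a::{t2_space, ab_group_add}"
  assumes G: "lca_group_on (UNIV :: 'a set)" and "x \<noteq> y"
  shows "\<exists>u::'a \<Rightarrow> real. continuous_on UNIV u \<and> u x \<noteq> u y"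
proof -
  obtain f :: "'a \<Rightarrow> real" and C where "continuous_on UNIV f"
      "\<And>z. z \<in> {x} \<Longrightarrow> f z = 1" "\<And>z. z \<notin> C \<inter> - {y} \<Longrightarrow> f z = 0"
    using lca_group_Urysohn[OF G, of "{x}" "- {y}"] assms(2)
    by (metis ComplI closed_singleton compact_sing empty_iff insert_iff open_Compl subsetI)
  then show ?thesis by (intro exI[of _ f]) auto
qed

section \<open>Integration against a Haar measure\<close>

lemma haar_measure_on_UNIV_D:
  fixes \<mu> :: "'a::{t2_space, ab_group_add} measure"
  assumes "haar_measure_on UNIV \<mu>"
  shows "space \<mu> = UNIV" and "sets \<mu> = sets borel"
    and "compact K \<Longrightarrow> emeasure \<mu> K < \<infinity>"
    and "open U \<Longrightarrow> U \<noteq> {} \<Longrightarrow> emeasure \<mu> U > 0"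
    and "A \<in> sets borel \<Longrightarrow> emeasure \<mu> A = (INF U\<in>{U. open U \<and> A \<subseteq> U}. emeasure \<mu> U)"
    and "open U \<Longrightarrow> emeasure \<mu> U = (SUP K\<in>{K. compact K \<and> K \<subseteq> U}. emeasure \<mu> K)"
    and "A \<in> sets borel \<Longrightarrow> emeasure \<mu> ((\<lambda>x. a + x) ` A) = emeasure \<mu> A"
proof -
  note h = assms[unfolded haar_measure_on_def subtopology_UNIV open_openin[symmetric]]
  show "space \<mu> = UNIV" and sets: "sets \<mu> = sets borel"
    using h by (simp_all add: sets_restrict_space)
  note h = h[unfolded sets, THEN conjunct2, THEN conjunct2]
  show "A \<in> sets borel \<Longrightarrow> emeasure \<mu> ((\<lambda>x. a + x) ` A) = emeasure \<mu> A"
    using h[THEN conjunct1] by simp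
  note h = h[THEN conjunct2]
  show "compact K \<Longrightarrow> emeasure \<mu> K < \<infinity>"
    using h[THEN conjunct1] by simp
  note h = h[THEN conjunct2]
  show "open U \<Longrightarrow> U \<noteq> {} \<Longrightarrow> emeasure \<mu> U > 0"
    using h[THEN conjunct1] by blast
  note h = h[THEN conjunct2]
  show "A \<in> sets borel \<Longrightarrow> emeasure \<mu> A = (INF U\<in>{U. open U \<and> A \<subseteq> U}. emeasure \<mu> U)"
    using h[THEN conjunct1] by (rule bspec)
  show "open U \<Longrightarrow> emeasure \<mu> U = (SUP K\<in>{K. compact K \<and> K \<subseteq> U}. emeasure \<mu> K)"
    using h[THEN conjunct2] by (rule allE) (erule mp)
qed

lemma nn_integral_haar_translate:
  fixes \<mu> :: "'a::{t2_space, ab_group_add} measure"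
  assumes G: "lca_group_on (UNIV :: 'a set)" and \<mu>: "haar_measure_on UNIV \<mu>"
    and h: "h \<in> borel_measurable borel"
  shows "(\<integral>\<^sup>+x. h (x + a) \<partial>\<mu>) = (\<integral>\<^sup>+x. h x \<partial>\<mu>)"
proof -
  note [measurable_cong] = haar_measure_on_UNIV_D(2)[OF \<mu>]
  have t[measurable]: "(\<lambda>x. x + a) \<in> borel \<rightarrow>\<^sub>M borel"
    by (intro borel_measurable_continuous_onI lca_group_continuous[OF G] continuous_intros)
  have "distr \<mu> borel (\<lambda>x. x + a) = \<mu>"
  proof (rule measure_eqI)
    fix A assume "A \<in> sets (distr \<mu> borel (\<lambda>x. x + a))"
    then have A: "A \<in> sets borel" by simp
    \<comment> \<open>Invariance is available for images of sets, whereas the image measure needs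
      preimages: the preimage under translation by \<open>a\<close> is the image under translation
      by \<open>- a\<close>.\<close>
    have "(\<lambda>x. x + a) -` A \<inter> space \<mu> = (\<lambda>x. - a + x) ` A"
    proof (intro equalityI subsetI)
      fix x assume "x \<in> (\<lambda>x. x + a) -` A \<inter> space \<mu>"
      then show "x \<in> (\<lambda>x. - a + x) ` A" by (intro image_eqI[of _ _ "x + a"]) simp_all
    qed (auto simp: haar_measure_on_UNIV_D(1)[OF \<mu>])
    then show "emeasure (distr \<mu> borel (\<lambda>x. x + a)) A = emeasure \<mu> A"
      using emeasure_distr[of "\<lambda>x. x + a" \<mu> borel A] A haar_measure_on_UNIV_D(7)[OF \<mu> A, of "- a"]
      by (simp only: t measurable_cong_sets[OF haar_measure_on_UNIV_D(2)[OF \<mu>] refl])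
  qed (use haar_measure_on_UNIV_D(2)[OF \<mu>] in simp)
  then show ?thesis
    using nn_integral_distr[of "\<lambda>x. x + a" \<mu> borel h] h by simp
qed

text \<open>The double integral of \<open>f x * g (y - x)\<close> is evaluated in two ways. With
  \<open>y\<close> innermost, invariance of \<nu> removes the shift and leaves the left side. With
  \<open>x\<close> innermost, invariance of \<mu> under \<open>x \<mapsto> x + y\<close> turns the
  integrand into \<open>f (x + y) * g (- x)\<close>; after a second exchange, invariance of \<nu>
  acts on \<open>f\<close>.\<close>

lemma nn_integral_haar_product:
  fixes \<mu> \<nu> :: "'a::{t2_space, ab_group_add} measure" and f g :: "'a \<Rightarrow> real"
  assumes G: "lca_group_on (UNIV :: 'a set)"
    and \<mu>: "haar_measure_on UNIV \<mu>" and \<nu>: "haar_measure_on UNIV \<nu>"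
    and f: "continuous_on UNIV f" "\<And>x. 0 \<le> f x" "compact K" "\<And>x. x \<notin> K \<Longrightarrow> f x = 0"
    and g: "continuous_on UNIV g" "\<And>x. 0 \<le> g x" "compact L" "\<And>x. x \<notin> L \<Longrightarrow> g x = 0"
  shows "(\<integral>\<^sup>+x. f x \<partial>\<mu>) * (\<integral>\<^sup>+x. g x \<partial>\<nu>) = (\<integral>\<^sup>+x. g (- x) \<partial>\<mu>) * (\<integral>\<^sup>+x. f x \<partial>\<nu>)"
proof -
  note cont = lca_group_continuous[OF G]
  note [measurable_cong] = haar_measure_on_UNIV_D(2)[OF \<mu>] haar_measure_on_UNIV_D(2)[OF \<nu>]
  have [measurable]: "f \<in> borel_measurable borel" "g \<in> borel_measurable borel"
    using f(1) g(1) by (auto intro: borel_measurable_continuous_onI)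
  have [measurable]: "(\<lambda>x::'a. - x) \<in> borel \<rightarrow>\<^sub>M borel" "(\<lambda>x::'a. x - a) \<in> borel \<rightarrow>\<^sub>M borel"
      "(\<lambda>x::'a. a - x) \<in> borel \<rightarrow>\<^sub>M borel" "(\<lambda>x::'a. a + x) \<in> borel \<rightarrow>\<^sub>M borel"
      "(\<lambda>x::'a. x + a) \<in> borel \<rightarrow>\<^sub>M borel" for a
    by (intro borel_measurable_continuous_onI cont continuous_intros)+
  \<comment> \<open>The sum set of \<open>K\<close> and \<open>L\<close> bounds the variable
    \<open>y\<close> in both exchanges: \<open>y\<close> is \<open>x + (y - x)\<close> in the first
    and \<open>(x + y) + (- x)\<close> in the second.\<close>
  define KL where "KL = (\<lambda>(x, y). x + y) ` (K \<times> L)"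
  have KL: "compact KL"
    unfolding KL_def using f(3) g(3) G
    by (intro compact_continuous_image compact_Times)
      (auto simp: lca_group_on_def intro: continuous_on_subset)
  have L': "compact (uminus ` L)"
    using compact_continuous_image[OF lca_group_continuous_minus[OF G continuous_on_id] g(3)] .
  have swap: "(\<integral>\<^sup>+x. \<integral>\<^sup>+y. ennreal (F x y) \<partial>\<nu> \<partial>\<mu>) = (\<integral>\<^sup>+y. \<integral>\<^sup>+x. ennreal (F x y) \<partial>\<mu> \<partial>\<nu>)"
    if "compact A" "compact B" "continuous_on UNIV (\<lambda>(x, y). F x y)"
      "\<And>x y. F x y \<noteq> 0 \<Longrightarrow> x \<in> A \<and> y \<in> B" for F A B
    by (rule nn_integral_swap_compact_support[where K = A and L = B])
      (fact that lca_group_separating[OF G] haar_measure_on_UNIV_D(2)[OF \<mu>]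
        haar_measure_on_UNIV_D(2)[OF \<nu>] haar_measure_on_UNIV_D(3)[OF \<mu> that(1)]
        haar_measure_on_UNIV_D(3)[OF \<nu> that(2)])+
  have "(\<integral>\<^sup>+x. f x \<partial>\<mu>) * (\<integral>\<^sup>+x. g x \<partial>\<nu>) = (\<integral>\<^sup>+x. f x * (\<integral>\<^sup>+y. g y \<partial>\<nu>) \<partial>\<mu>)"
    by (rule nn_integral_multc[symmetric]) measurable
  also have "\<dots> = (\<integral>\<^sup>+x. f x * (\<integral>\<^sup>+y. g (y - x) \<partial>\<nu>) \<partial>\<mu>)"
    using nn_integral_haar_translate[OF G \<nu>, of "\<lambda>y. ennreal (g y)" "- _"] by simp
  also have "\<dots> = (\<integral>\<^sup>+x. \<integral>\<^sup>+y. ennreal (f x * g (y - x)) \<partial>\<nu> \<partial>\<mu>)"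
    by (simp add: nn_integral_cmult ennreal_mult f(2) g(2))
  also have "\<dots> = (\<integral>\<^sup>+y. \<integral>\<^sup>+x. ennreal (f x * g (y - x)) \<partial>\<mu> \<partial>\<nu>)"
  proof (rule swap[OF f(3) KL])
    show "continuous_on UNIV (\<lambda>(x, y). f x * g (y - x))"
      unfolding case_prod_beta
      by (intro continuous_on_mult continuous_on_compose2[OF f(1)] continuous_on_compose2[OF g(1)]
          cont continuous_intros) auto
    show "x \<in> K \<and> y \<in> KL" if "f x * g (y - x) \<noteq> 0" for x y
    proof -
      have "x \<in> K" "y - x \<in> L" using that f(4) g(4) by auto
      then show ?thesis unfolding KL_def by (auto intro!: image_eqI[of _ _ "(x, y - x)"])
    qed
  qed
  also have "\<dots> = (\<integral>\<^sup>+y. \<integral>\<^sup>+x. ennreal (f (x + y) * g (- x)) \<partial>\<mu> \<partial>\<nu>)"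
  proof (rule nn_integral_cong)
    fix y
    show "(\<integral>\<^sup>+x. ennreal (f x * g (y - x)) \<partial>\<mu>) = (\<integral>\<^sup>+x. ennreal (f (x + y) * g (- x)) \<partial>\<mu>)"
      using nn_integral_haar_translate[OF G \<mu>, of "\<lambda>x. ennreal (f x * g (y - x))" y] by simp
  qed
  also have "\<dots> = (\<integral>\<^sup>+x. \<integral>\<^sup>+y. ennreal (f (x + y) * g (- x)) \<partial>\<nu> \<partial>\<mu>)"
  proof (rule swap[OF L' KL, symmetric])
    show "continuous_on UNIV (\<lambda>(x, y). f (x + y) * g (- x))"
      unfolding case_prod_beta
      by (intro continuous_on_mult continuous_on_compose2[OF f(1)] continuous_on_compose2[OF g(1)]
          cont continuous_intros) auto
    show "x \<in> uminus ` L \<and> y \<in> KL" if "f (x + y) * g (- x) \<noteq> 0" for x y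
    proof -
      have "x + y \<in> K" "- x \<in> L" using that f(4) g(4) by auto
      then show ?thesis
        unfolding KL_def
        by (intro conjI image_eqI[of _ _ "- x"] image_eqI[of _ _ "(x + y, - x)"]) simp_all
    qed
  qed
  also have "\<dots> = (\<integral>\<^sup>+x. g (- x) * (\<integral>\<^sup>+y. f (y + x) \<partial>\<nu>) \<partial>\<mu>)"
    by (simp add: nn_integral_cmult[symmetric] ennreal_mult f(2) g(2) mult.commute[of "f _"]
        add.commute)
  also have "\<dots> = (\<integral>\<^sup>+x. g (- x) * (\<integral>\<^sup>+y. f y \<partial>\<nu>) \<partial>\<mu>)"
    using nn_integral_haar_translate[OF G \<nu>, of "\<lambda>y. ennreal (f y)"] by simp
  also have "\<dots> = (\<integral>\<^sup>+x. g (- x) \<partial>\<mu>) * (\<integral>\<^sup>+x. f x \<partial>\<nu>)"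
    by (rule nn_integral_multc) measurable
  finally show ?thesis .
qed

lemma nn_integral_haar_compact_support_finite:
  fixes \<mu> :: "'a::{t2_space, ab_group_add} measure" and g :: "'a \<Rightarrow> real"
  assumes \<mu>: "haar_measure_on UNIV \<mu>"
    and g: "\<And>x. g x \<le> B" "compact L" "\<And>x. x \<notin> L \<Longrightarrow> g x = 0"
  shows "(\<integral>\<^sup>+x. g x \<partial>\<mu>) < \<infinity>"
proof -
  note [measurable_cong] = haar_measure_on_UNIV_D(2)[OF \<mu>]
  have [measurable]: "L \<in> sets borel"
    using g(2) by (intro borel_closed compact_imp_closed)
  have "(\<integral>\<^sup>+x. g x \<partial>\<mu>) \<le> (\<integral>\<^sup>+x. ennreal B * indicator L x \<partial>\<mu>)"
    using g by (intro nn_integral_mono) (auto simp: indicator_def ennreal_leI)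
  also have "\<dots> = ennreal B * emeasure \<mu> L"
    by (simp add: nn_integral_cmult_indicator)
  also have "\<dots> < \<infinity>"
    using haar_measure_on_UNIV_D(3)[OF \<mu> g(2)] by (simp add: ennreal_mult_less_top)
  finally show ?thesis .
qed

text \<open>The set where \<open>g\<close> is positive is open and nonempty, hence of positive
  measure. Negative values of \<open>g\<close> become zero in \<open>ennreal\<close>.\<close>

lemma nn_integral_haar_pos:
  fixes \<mu> :: "'a::{t2_space, ab_group_add} measure" and g :: "'a \<Rightarrow> real"
  assumes \<mu>: "haar_measure_on UNIV \<mu>"
    and g: "continuous_on UNIV g" "0 < g a"
  shows "0 < (\<integral>\<^sup>+x. g x \<partial>\<mu>)"
proof -
  note [measurable_cong] = haar_measure_on_UNIV_D(2)[OF \<mu>]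
  have [measurable]: "g \<in> borel_measurable borel"
    using g(1) by (rule borel_measurable_continuous_onI)
  have "open {x. 0 < g x}"
    using g(1) by (intro open_Collect_less continuous_intros)
  then have "emeasure \<mu> {x. 0 < g x} > 0"
    using g(2) by (intro haar_measure_on_UNIV_D(4)[OF \<mu>]) auto
  moreover have "{x \<in> space \<mu>. ennreal (g x) \<noteq> 0} = {x. 0 < g x}"
    using haar_measure_on_UNIV_D(1)[OF \<mu>] by (auto simp: ennreal_eq_0_iff not_le)
  ultimately have "(\<integral>\<^sup>+x. g x \<partial>\<mu>) \<noteq> 0"
    by (subst nn_integral_0_iff) auto
  then show ?thesis by (simp add: zero_less_iff_neq_zero)
qed

section \<open>Comparison of two Haar measures\<close>

text \<open>For compact \<open>K\<close> inside open \<open>U\<close>, a Urysohn function lies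
  between the two indicators. Inner regularity of \<mu> then gives the inequality on open sets, and
  outer regularity of \<nu> extends it to Borel sets.\<close>

lemma haar_measure_le_of_nn_integral_le:
  fixes \<mu> \<nu> :: "'a::{t2_space, ab_group_add} measure"
  assumes G: "lca_group_on (UNIV :: 'a set)"
    and \<mu>: "haar_measure_on UNIV \<mu>" and \<nu>: "haar_measure_on UNIV \<nu>"
    and le: "\<And>(f :: 'a \<Rightarrow> real) K. continuous_on UNIV f \<Longrightarrow> (\<And>x. 0 \<le> f x) \<Longrightarrow> compact K \<Longrightarrow>
        (\<And>x. x \<notin> K \<Longrightarrow> f x = 0) \<Longrightarrow> c * (\<integral>\<^sup>+x. ennreal (f x) \<partial>\<mu>) \<le> (\<integral>\<^sup>+x. ennreal (f x) \<partial>\<nu>)"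
    and A: "A \<in> sets borel"
  shows "c * emeasure \<mu> A \<le> emeasure \<nu> A"
proof -
  note [measurable_cong] = haar_measure_on_UNIV_D(2)[OF \<mu>] haar_measure_on_UNIV_D(2)[OF \<nu>]
  have "open": "c * emeasure \<mu> U \<le> emeasure \<nu> U" if U: "open U" for U
    unfolding haar_measure_on_UNIV_D(6)[OF \<mu> U] SUP_mult_left_ennreal
  proof (rule SUP_least)
    fix K assume "K \<in> {K. compact K \<and> K \<subseteq> U}"
    then have K: "compact K" "K \<subseteq> U" by auto
    have [measurable]: "K \<in> sets borel" "U \<in> sets borel"
      using K U by (auto intro: borel_closed compact_imp_closed)
    obtain f :: "'a \<Rightarrow> real" and C where f: "continuous_on UNIV f" "compact C"
      "\<And>x. f x \<in> {0..1}" "\<And>x. x \<in> K \<Longrightarrow> f x = 1" "\<And>x. x \<notin> C \<inter> U \<Longrightarrow> f x = 0"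
      using lca_group_Urysohn[OF G K(1) U K(2)] by metis
    have "emeasure \<mu> K = (\<integral>\<^sup>+x. indicator K x \<partial>\<mu>)" by simp
    also have "\<dots> \<le> (\<integral>\<^sup>+x. f x \<partial>\<mu>)"
      using f(4) by (intro nn_integral_mono) (auto simp: indicator_def)
    finally have "c * emeasure \<mu> K \<le> c * (\<integral>\<^sup>+x. f x \<partial>\<mu>)"
      by (intro mult_left_mono) auto
    also have "\<dots> \<le> (\<integral>\<^sup>+x. f x \<partial>\<nu>)"
      using f by (intro le[of f C]) auto
    also have "\<dots> \<le> (\<integral>\<^sup>+x. indicator U x \<partial>\<nu>)"
      using f(3,5) by (intro nn_integral_mono) (auto simp: indicator_def)
    also have "\<dots> = emeasure \<nu> U" by simp
    finally show "c * emeasure \<mu> K \<le> emeasure \<nu> U" .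
  qed
  show ?thesis
    unfolding haar_measure_on_UNIV_D(5)[OF \<nu> A]
  proof (rule INF_greatest)
    fix U assume "U \<in> {U. open U \<and> A \<subseteq> U}"
    then have U: "open U" "A \<subseteq> U" by auto
    then have "c * emeasure \<mu> A \<le> c * emeasure \<mu> U"
      by (intro mult_left_mono emeasure_mono) auto
    also have "\<dots> \<le> emeasure \<nu> U" using U(1) by (rule "open")
    finally show "c * emeasure \<mu> A \<le> emeasure \<nu> U" .
  qed
qed

text \<open>In the product identity a fixed symmetric bump \<open>g\<close> makes the reflected
  integral an ordinary one. The integrals of every \<open>f\<close> against \<mu> and \<nu> are then
  in the fixed ratio of the integrals of \<open>g\<close>, and regularity transfers this ratio to
  sets.\<close>

theorem haar_measure_unique:
  fixes \<mu> \<nu> :: "'a::{t2_space, ab_group_add} measure"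
  assumes G: "lca_group_on (UNIV :: 'a set)"
    and \<mu>: "haar_measure_on UNIV \<mu>" and \<nu>: "haar_measure_on UNIV \<nu>"
  obtains c :: real where "0 < c" "\<nu> = density \<mu> (\<lambda>_. ennreal c)"
proof -
  obtain k :: "'a \<Rightarrow> real" and C where k: "continuous_on UNIV k" "compact C"
      "\<And>x. k x \<in> {0..1}" "\<And>x. x \<in> {0} \<Longrightarrow> k x = 1" "\<And>x. x \<notin> C \<inter> UNIV \<Longrightarrow> k x = 0"
    using lca_group_Urysohn[OF G, of "{0}" UNIV] by (metis compact_sing open_UNIV subset_UNIV)
  \<comment> \<open>Symmetrising replaces an appeal to invariance of \<mu> under inversion. The
    value of \<open>g\<close> at the origin is 2, so both of its integrals are positive.\<close>
  define g where "g = (\<lambda>x. k x + k (- x))"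
  define L where "L = C \<union> uminus ` C"
  have g: "continuous_on UNIV g" "\<And>x. 0 \<le> g x" "\<And>x. g x \<le> 2" "g (- x) = g x" "0 < g 0" for x
  proof -
    show "continuous_on UNIV g" unfolding g_def
      by (intro continuous_on_add k(1) continuous_on_compose2[OF k(1)]
          lca_group_continuous[OF G] continuous_intros) auto
    show "0 \<le> g x" "g x \<le> 2" for x using k(3)[of x] k(3)[of "- x"] by (auto simp: g_def)
  qed (auto simp: g_def k(4))
  have L: "compact L"
    unfolding L_def
    by (intro compact_Un k(2) compact_continuous_image lca_group_continuous[OF G] continuous_intros)
  have gL: "g x = 0" if "x \<notin> L" for x
  proof -
    have "x \<notin> C" "- x \<notin> C"
      using that unfolding L_def by (auto intro: image_eqI[of _ _ "- x"])
    then show ?thesis by (simp add: g_def k(5))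
  qed
  define a where "a = enn2real (\<integral>\<^sup>+x. g x \<partial>\<mu>)"
  define b where "b = enn2real (\<integral>\<^sup>+x. g x \<partial>\<nu>)"
  have a: "(\<integral>\<^sup>+x. g x \<partial>\<mu>) = ennreal a" "0 < a"
    using nn_integral_haar_compact_support_finite[OF \<mu> g(3) L gL]
      nn_integral_haar_pos[OF \<mu> g(1) g(5)]
    by (auto simp: a_def enn2real_positive_iff)
  have b: "(\<integral>\<^sup>+x. g x \<partial>\<nu>) = ennreal b" "0 < b"
    using nn_integral_haar_compact_support_finite[OF \<nu> g(3) L gL]
      nn_integral_haar_pos[OF \<nu> g(1) g(5)]
    by (auto simp: b_def enn2real_positive_iff)
  have propor: "ennreal b * (\<integral>\<^sup>+x. f x \<partial>\<mu>) = ennreal a * (\<integral>\<^sup>+x. f x \<partial>\<nu>)"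
    if "continuous_on UNIV f" "\<And>x. 0 \<le> f x" "compact K" "\<And>x. x \<notin> K \<Longrightarrow> f x = 0"
    for f :: "'a \<Rightarrow> real" and K
    using nn_integral_haar_product[OF G \<mu> \<nu> that g(1,2) L gL] by (simp add: a b g(4) mult.commute)
  have 1: "ennreal (b / a) * emeasure \<mu> A \<le> emeasure \<nu> A" if "A \<in> sets borel" for A
  proof (rule haar_measure_le_of_nn_integral_le[OF G \<mu> \<nu> _ that])
    fix f :: "'a \<Rightarrow> real" and K
    assume "continuous_on UNIV f" "\<And>x. 0 \<le> f x" "compact K" "\<And>x. x \<notin> K \<Longrightarrow> f x = 0"
    note propor[OF this]
    then have "ennreal (1 / a) * (ennreal b * (\<integral>\<^sup>+x. f x \<partial>\<mu>)) = (\<integral>\<^sup>+x. f x \<partial>\<nu>)"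
      using a(2) by (simp flip: mult.assoc ennreal_mult)
    then show "ennreal (b / a) * (\<integral>\<^sup>+x. f x \<partial>\<mu>) \<le> (\<integral>\<^sup>+x. f x \<partial>\<nu>)"
      using a(2) b(2) by (simp flip: mult.assoc ennreal_mult)
  qed
  have 2: "ennreal (a / b) * emeasure \<nu> A \<le> emeasure \<mu> A" if "A \<in> sets borel" for A
  proof (rule haar_measure_le_of_nn_integral_le[OF G \<nu> \<mu> _ that])
    fix f :: "'a \<Rightarrow> real" and K
    assume "continuous_on UNIV f" "\<And>x. 0 \<le> f x" "compact K" "\<And>x. x \<notin> K \<Longrightarrow> f x = 0"
    note propor[OF this, symmetric]
    then have "ennreal (1 / b) * (ennreal a * (\<integral>\<^sup>+x. f x \<partial>\<nu>)) = (\<integral>\<^sup>+x. f x \<partial>\<mu>)"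
      using b(2) by (simp flip: mult.assoc ennreal_mult)
    then show "ennreal (a / b) * (\<integral>\<^sup>+x. f x \<partial>\<nu>) \<le> (\<integral>\<^sup>+x. f x \<partial>\<mu>)"
      using a(2) b(2) by (simp flip: mult.assoc ennreal_mult)
  qed
  have "\<nu> = density \<mu> (\<lambda>_. ennreal (b / a))"
  proof (rule measure_eqI)
    show "sets \<nu> = sets (density \<mu> (\<lambda>_. ennreal (b / a)))"
      using haar_measure_on_UNIV_D(2)[OF \<mu>] haar_measure_on_UNIV_D(2)[OF \<nu>] by simp
    fix A assume "A \<in> sets \<nu>"
    then have A: "A \<in> sets borel" "A \<in> sets \<mu>"
      using haar_measure_on_UNIV_D(2)[OF \<mu>] haar_measure_on_UNIV_D(2)[OF \<nu>] by auto
    \<comment> \<open>Inequality \<open>2\<close>, multiplied by \<open>b / a\<close>, becomes the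
      reverse of inequality \<open>1\<close>.\<close>
    have "emeasure \<nu> A = ennreal (b / a) * (ennreal (a / b) * emeasure \<nu> A)"
      using a(2) b(2) by (simp flip: mult.assoc ennreal_mult)
    also have "\<dots> \<le> ennreal (b / a) * emeasure \<mu> A"
      using 2[OF A(1)] by (intro mult_left_mono) auto
    finally have "emeasure \<nu> A = ennreal (b / a) * emeasure \<mu> A"
      using 1[OF A(1)] by (rule antisym)
    then show "emeasure \<nu> A = emeasure (density \<mu> (\<lambda>_. ennreal (b / a))) A"
      using A(2) by (simp add: emeasure_density_const)
  qed
  then show thesis
    using a(2) b(2) by (intro that[of "b / a"]) auto
qed

subsection \<open>Transfer of weak amenability\<close>

text \<open>Functions are defined on the whole type, while the space of a measure may be smaller, as
  for the antidiagonal. This lemma and the next two make values off the space irrelevant.\<close>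

lemma L1w_null:
  assumes "\<And>x. x \<in> space \<mu> \<Longrightarrow> d x = 0"
  shows "d \<in> L1w \<mu> \<omega>" and "L1w_norm \<mu> \<omega> d = 0"
proof -
  have "d \<in> borel_measurable \<mu> \<longleftrightarrow> (\<lambda>_. 0::complex) \<in> borel_measurable \<mu>"
    using assms by (intro measurable_cong) auto
  moreover have "integrable \<mu> (\<lambda>x. cmod (d x) * \<omega> x) \<longleftrightarrow> integrable \<mu> (\<lambda>_. 0::real)"
    using assms by (intro Bochner_Integration.integrable_cong) auto
  ultimately show "d \<in> L1w \<mu> \<omega>" by (simp add: L1w_def)
  have "L1w_norm \<mu> \<omega> d = (\<integral>x. 0 \<partial>\<mu>)"
    unfolding L1w_norm_def using assms by (intro Bochner_Integration.integral_cong) auto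
  then show "L1w_norm \<mu> \<omega> d = 0" by simp
qed

text \<open>The difference of the two functions has seminorm zero, so boundedness forces the
  functional to vanish on it.\<close>

lemma bounded_functional_cong:
  assumes "bounded_functional \<mu> \<omega> \<phi>" "f \<in> L1w \<mu> \<omega>"
    and eq: "\<And>x. x \<in> space \<mu> \<Longrightarrow> g x = f x"
  shows "\<phi> g = \<phi> f"
proof -
  define d where "d = (\<lambda>x. g x - f x)"
  have d: "d \<in> L1w \<mu> \<omega>" "L1w_norm \<mu> \<omega> d = 0"
    using eq by (auto intro!: L1w_null simp: d_def)
  obtain C where "cmod (\<phi> d) \<le> C * L1w_norm \<mu> \<omega> d"
    using assms(1) d(1) unfolding bounded_functional_def by blast
  then have "\<phi> d = 0" using d(2) by simp
  moreover have "\<phi> (\<lambda>x. f x + d x) = \<phi> f + \<phi> d"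
    using assms(1,2) d(1) unfolding bounded_functional_def by blast
  ultimately show ?thesis by (simp add: d_def)
qed

text \<open>The joint bound on \<open>D\<close> makes it a bounded functional in its first argument
  too, so the arguments can be replaced one at a time.\<close>

lemma bounded_derivation_cong:
  assumes D: "bounded_derivation \<mu> \<omega> D" and f: "f \<in> L1w \<mu> \<omega>" and h: "h \<in> L1w \<mu> \<omega>"
    and g: "g \<in> L1w \<mu> \<omega>"
    and "\<And>x. x \<in> space \<mu> \<Longrightarrow> g x = f x" "\<And>x. x \<in> space \<mu> \<Longrightarrow> k x = h x"
  shows "D g k = D f h"
proof -
  have "bounded_functional \<mu> \<omega> (D g)"
    using D g by (auto simp: bounded_derivation_def)
  then have "D g k = D g h" using h assms(6) by (rule bounded_functional_cong)
  have "bounded_functional \<mu> \<omega> (\<lambda>f. D f h)"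
  proof -
    obtain C where "\<forall>f\<in>L1w \<mu> \<omega>. \<forall>h\<in>L1w \<mu> \<omega>. cmod (D f h) \<le> C * L1w_norm \<mu> \<omega> f * L1w_norm \<mu> \<omega> h"
      using D unfolding bounded_derivation_def by blast
    then have "\<forall>f\<in>L1w \<mu> \<omega>. cmod (D f h) \<le> (C * L1w_norm \<mu> \<omega> h) * L1w_norm \<mu> \<omega> f"
      using h by (simp add: mult_ac)
    then show ?thesis
      using D h unfolding bounded_derivation_def bounded_functional_def by blast
  qed
  then have "D g h = D f h" using f assms(5) by (rule bounded_functional_cong)
  with \<open>D g k = D g h\<close> show ?thesis by simp
qed

text \<open>Additivity, homogeneity and multiplicativity are equations between functions, not merely
almost everywhere: a derivation is unconstrained outside the space of integrable functions, and
convolutions are not known to belong to it.\<close>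
definition L1w_isometric_hom :: "('a::ab_group_add) measure \<Rightarrow> ('a \<Rightarrow> real) \<Rightarrow>
    ('b::ab_group_add) measure \<Rightarrow> ('b \<Rightarrow> real) \<Rightarrow> (('a \<Rightarrow> complex) \<Rightarrow> 'b \<Rightarrow> complex) \<Rightarrow> bool" where
  "L1w_isometric_hom \<mu> \<omega> \<nu> \<eta> \<Phi> \<longleftrightarrow>
     (\<forall>f\<in>L1w \<mu> \<omega>. \<Phi> f \<in> L1w \<nu> \<eta> \<and> L1w_norm \<nu> \<eta> (\<Phi> f) = L1w_norm \<mu> \<omega> f) \<and>
     (\<forall>f g. \<Phi> (\<lambda>x. f x + g x) = (\<lambda>x. \<Phi> f x + \<Phi> g x)) \<and>
     (\<forall>f c. \<Phi> (\<lambda>x. c * f x) = (\<lambda>x. c * \<Phi> f x)) \<and>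
     (\<forall>f\<in>L1w \<mu> \<omega>. \<forall>g\<in>L1w \<mu> \<omega>. \<Phi> (conv \<mu> f g) = conv \<nu> (\<Phi> f) (\<Phi> g))"

lemma L1w_isometric_homD:
  assumes "L1w_isometric_hom \<mu> \<omega> \<nu> \<eta> \<Phi>"
  shows "f \<in> L1w \<mu> \<omega> \<Longrightarrow> \<Phi> f \<in> L1w \<nu> \<eta>"
    and "f \<in> L1w \<mu> \<omega> \<Longrightarrow> L1w_norm \<nu> \<eta> (\<Phi> f) = L1w_norm \<mu> \<omega> f"
    and "\<Phi> (\<lambda>x. f x + g x) = (\<lambda>x. \<Phi> f x + \<Phi> g x)"
    and "\<Phi> (\<lambda>x. c * f x) = (\<lambda>x. c * \<Phi> f x)"
    and "f \<in> L1w \<mu> \<omega> \<Longrightarrow> g \<in> L1w \<mu> \<omega> \<Longrightarrow> \<Phi> (conv \<mu> f g) = conv \<nu> (\<Phi> f) (\<Phi> g)"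
  using assms unfolding L1w_isometric_hom_def by blast+

lemma bounded_functional_pullback:
  assumes "L1w_isometric_hom \<mu> \<omega> \<nu> \<eta> \<Phi>" "bounded_functional \<nu> \<eta> \<phi>"
  shows "bounded_functional \<mu> \<omega> (\<lambda>f. \<phi> (\<Phi> f))"
proof -
  note hom = L1w_isometric_homD[OF assms(1)]
  obtain C where "\<forall>f\<in>L1w \<nu> \<eta>. cmod (\<phi> f) \<le> C * L1w_norm \<nu> \<eta> f"
    using assms(2) unfolding bounded_functional_def by blast
  then have "\<forall>f\<in>L1w \<mu> \<omega>. cmod (\<phi> (\<Phi> f)) \<le> C * L1w_norm \<mu> \<omega> f"
    using hom(1,2) by metis
  moreover have "\<phi> (\<lambda>x. u x + v x) = \<phi> u + \<phi> v" if "u \<in> L1w \<nu> \<eta>" "v \<in> L1w \<nu> \<eta>" for u v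
    using assms(2) that unfolding bounded_functional_def by blast
  moreover have "\<phi> (\<lambda>x. c * u x) = c * \<phi> u" if "u \<in> L1w \<nu> \<eta>" for u c
    using assms(2) that unfolding bounded_functional_def by blast
  ultimately show ?thesis
    using hom unfolding bounded_functional_def by (auto simp only: hom)
qed

text \<open>Multiplicativity serves the Leibniz rule, where \<Phi> passes through all three
  convolutions, including those in the second argument of \<open>D\<close>.\<close>

lemma bounded_derivation_pullback:
  assumes \<Phi>: "L1w_isometric_hom \<mu> \<omega> \<nu> \<eta> \<Phi>" and D: "bounded_derivation \<nu> \<eta> D"
  shows "bounded_derivation \<mu> \<omega> (\<lambda>f h. D (\<Phi> f) (\<Phi> h))"
proof -
  note hom = L1w_isometric_homD[OF \<Phi>]
  obtain C where C: "\<forall>f\<in>L1w \<nu> \<eta>. \<forall>h\<in>L1w \<nu> \<eta>. cmod (D f h) \<le> C * L1w_norm \<nu> \<eta> f * L1w_norm \<nu> \<eta> h"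
    using D unfolding bounded_derivation_def by blast
  have "cmod (D (\<Phi> f) (\<Phi> h)) \<le> C * L1w_norm \<mu> \<omega> f * L1w_norm \<mu> \<omega> h"
    if "f \<in> L1w \<mu> \<omega>" "h \<in> L1w \<mu> \<omega>" for f h
    using C[rule_format, OF hom(1)[OF that(1)] hom(1)[OF that(2)]] that by (simp only: hom)
  moreover have "bounded_functional \<mu> \<omega> (\<lambda>h. D (\<Phi> f) (\<Phi> h))" if "f \<in> L1w \<mu> \<omega>" for f
    using D hom(1)[OF that] unfolding bounded_derivation_def
    by (intro bounded_functional_pullback[OF \<Phi>]) blast
  moreover have "D (\<lambda>x. u x + v x) w = D u w + D v w"
    if "u \<in> L1w \<nu> \<eta>" "v \<in> L1w \<nu> \<eta>" "w \<in> L1w \<nu> \<eta>" for u v w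
    using D that unfolding bounded_derivation_def by blast
  moreover have "D (\<lambda>x. c * u x) w = c * D u w"
    if "u \<in> L1w \<nu> \<eta>" "w \<in> L1w \<nu> \<eta>" for c u w
    using D that unfolding bounded_derivation_def by blast
  moreover have "D (conv \<nu> u v) w = D v (conv \<nu> w u) + D u (conv \<nu> v w)"
    if "u \<in> L1w \<nu> \<eta>" "v \<in> L1w \<nu> \<eta>" "w \<in> L1w \<nu> \<eta>" for u v w
    using D that unfolding bounded_derivation_def by blast
  ultimately show ?thesis
    unfolding bounded_derivation_def by (intro conjI ballI allI exI[of _ C]) (simp_all only: hom)
qed

text \<open>Pulled back along \<Psi>, a derivation on the first algebra becomes one on the second
  and is inner there; the implementing functional composed with \<Phi> implements the original. The
  inversion formula is restricted to the space of \<mu> because extending a restriction from the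
  antidiagonal does not recover values off it.\<close>

lemma weakly_amenable_L1_transfer:
  assumes \<Phi>: "L1w_isometric_hom \<mu> \<omega> \<nu> \<eta> \<Phi>" and \<Psi>: "L1w_isometric_hom \<nu> \<eta> \<mu> \<omega> \<Psi>"
    and inv: "\<And>f x. x \<in> space \<mu> \<Longrightarrow> \<Psi> (\<Phi> f) x = f x"
    and wa: "weakly_amenable_L1 \<nu> \<eta>"
  shows "weakly_amenable_L1 \<mu> \<omega>"
  unfolding weakly_amenable_L1_def
proof (intro allI impI)
  fix D assume D: "bounded_derivation \<mu> \<omega> D"
  have mem: "\<Phi> f \<in> L1w \<nu> \<eta>" if "f \<in> L1w \<mu> \<omega>" for f using L1w_isometric_homD(1)[OF \<Phi>] that .
  have mem': "\<Psi> f \<in> L1w \<mu> \<omega>" if "f \<in> L1w \<nu> \<eta>" for f using L1w_isometric_homD(1)[OF \<Psi>] that .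
  have "inner_derivation \<nu> \<eta> (\<lambda>f h. D (\<Psi> f) (\<Psi> h))"
    using wa[unfolded weakly_amenable_L1_def, rule_format, OF bounded_derivation_pullback[OF \<Psi> D]] .
  then obtain \<phi> where \<phi>: "bounded_functional \<nu> \<eta> \<phi>"
    and eq: "\<And>f h. f \<in> L1w \<nu> \<eta> \<Longrightarrow> h \<in> L1w \<nu> \<eta> \<Longrightarrow>
      D (\<Psi> f) (\<Psi> h) = \<phi> (conv \<nu> h f) - \<phi> (conv \<nu> f h)"
    unfolding inner_derivation_def by blast
  show "inner_derivation \<mu> \<omega> D"
    unfolding inner_derivation_def
  proof (intro exI conjI ballI)
    show "bounded_functional \<mu> \<omega> (\<lambda>f. \<phi> (\<Phi> f))"
      by (rule bounded_functional_pullback[OF \<Phi> \<phi>])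
    fix f h assume fh: "f \<in> L1w \<mu> \<omega>" "h \<in> L1w \<mu> \<omega>"
    \<comment> \<open>The arguments agree only on the space of \<mu>, so equality of the values of
      \<open>D\<close> rests on its boundedness.\<close>
    have "D f h = D (\<Psi> (\<Phi> f)) (\<Psi> (\<Phi> h))"
      using fh mem[THEN mem'] by (intro bounded_derivation_cong[OF D, symmetric] inv)
    also have "\<dots> = \<phi> (\<Phi> (conv \<mu> h f)) - \<phi> (\<Phi> (conv \<mu> f h))"
      using eq[OF mem mem, OF fh] fh by (simp only: L1w_isometric_homD(5)[OF \<Phi>])
    finally show "D f h = \<phi> (\<Phi> (conv \<mu> h f)) - \<phi> (\<Phi> (conv \<mu> f h))" .
  qed
qed

subsection \<open>The antidiagonal\<close>

lemma anti_diag_eq: "p \<in> anti_diag \<Longrightarrow> (fst p, - fst p) = p"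
  by (auto simp: anti_diag_def)

lemma anti_diag_image: "(\<lambda>x. (x, - x)) ` A = anti_diag \<inter> fst -` A"
  by (auto simp: anti_diag_def)

lemma continuous_on_anti_diag_embedding:
  assumes "lca_group_on (UNIV :: 'a::{t2_space, ab_group_add} set)"
  shows "continuous_on S (\<lambda>x::'a. (x, - x))"
  using assms by (intro continuous_on_Pair lca_group_continuous_minus continuous_on_id)

text \<open>The embedding is a homeomorphism onto the antidiagonal with inverse \<open>fst\<close>.
  An equality of families can rewrite the index set of the infimum in outer regularity.\<close>

lemma openin_anti_diag_image:
  assumes G: "lca_group_on (UNIV :: 'a::{t2_space, ab_group_add} set)"
  shows "{V. openin (top_of_set anti_diag) V \<and> (\<lambda>x::'a. (x, - x)) ` A \<subseteq> V} =
    (`) (\<lambda>x. (x, - x)) ` {U. open U \<and> A \<subseteq> U}" (is "?L = ?R")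
proof (intro equalityI subsetI)
  fix V assume "V \<in> ?L"
  then obtain W where W: "open W" "V = anti_diag \<inter> W" "(\<lambda>x. (x, - x)) ` A \<subseteq> V"
    by (auto simp: openin_open)
  let ?U = "(\<lambda>x. (x, - x)) -` W"
  have "open ?U"
    using W(1) continuous_on_anti_diag_embedding[OF G] by (rule open_vimage)
  moreover have "V = (\<lambda>x. (x, - x)) ` ?U"
    unfolding W(2) by (auto simp: anti_diag_def)
  moreover have "A \<subseteq> ?U" using W by auto
  ultimately show "V \<in> ?R" by blast
next
  fix V assume "V \<in> ?R"
  then obtain U where U: "open U" "A \<subseteq> U" "V = (\<lambda>x. (x, - x)) ` U" by blast
  have "openin (top_of_set anti_diag) V"
    unfolding U(3) anti_diag_image openin_open using U(1) by (blast intro: open_vimage_fst)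
  then show "V \<in> ?L" using U by blast
qed

lemma compact_anti_diag_image:
  assumes G: "lca_group_on (UNIV :: 'a::{t2_space, ab_group_add} set)"
  shows "{K. compact K \<and> K \<subseteq> (\<lambda>x::'a. (x, - x)) ` U} =
    (`) (\<lambda>x. (x, - x)) ` {K. compact K \<and> K \<subseteq> U}" (is "?L = ?R")
proof (intro equalityI subsetI)
  fix K assume "K \<in> ?L"
  then have K: "compact K" "K \<subseteq> (\<lambda>x. (x, - x)) ` U" by auto
  have "compact (fst ` K)"
    using K(1) by (intro compact_continuous_image continuous_on_fst continuous_on_id)
  moreover have "fst ` K \<subseteq> U" "K = (\<lambda>x. (x, - x)) ` fst ` K"
    using K(2) by force+
  ultimately show "K \<in> ?R" by blast
next
  fix K assume "K \<in> ?R"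
  then obtain C where "compact C" "C \<subseteq> U" "K = (\<lambda>x. (x, - x)) ` C" by blast
  then show "K \<in> ?L"
    using compact_continuous_image[OF continuous_on_anti_diag_embedding[OF G], of C] by auto
qed

section \<open>Haar measure on the antidiagonal\<close>

lemma measurable_fst_anti_diag:
  fixes \<nu> :: "('a::{t2_space, ab_group_add} \<times> 'a) measure"
  assumes "haar_measure_on anti_diag \<nu>"
  shows "fst \<in> \<nu> \<rightarrow>\<^sub>M borel"
proof -
  have "fst \<in> restrict_space borel anti_diag \<rightarrow>\<^sub>M (borel :: 'a measure)"
    by (intro borel_measurable_continuous_on_restrict continuous_on_fst continuous_on_id)
  moreover have "sets \<nu> = sets (restrict_space borel anti_diag)"
    using assms by (simp add: haar_measure_on_def)
  note measurable_cong_sets[OF this refl, of borel]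
  ultimately show ?thesis by blast
qed

lemma measurable_anti_diag_embedding:
  fixes \<nu> :: "('a::{t2_space, ab_group_add} \<times> 'a) measure"
  assumes G: "lca_group_on (UNIV :: 'a set)" and \<nu>: "haar_measure_on anti_diag \<nu>"
  shows "(\<lambda>x. (x, - x)) \<in> borel \<rightarrow>\<^sub>M \<nu>"
proof -
  have "(\<lambda>x::'a. (x, - x)) \<in> borel \<rightarrow>\<^sub>M restrict_space borel anti_diag"
    by (intro measurable_restrict_space2 borel_measurable_continuous_onI
        continuous_on_anti_diag_embedding[OF G]) (auto simp: anti_diag_def)
  moreover have "sets \<nu> = sets (restrict_space borel anti_diag)"
    using \<nu> by (simp add: haar_measure_on_def)
  note measurable_cong_sets[OF refl this, of borel]
  ultimately show ?thesis by blast
qed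

lemma haar_measure_on_distr_fst:
  fixes \<nu> :: "('a::{t2_space, ab_group_add} \<times> 'a) measure"
  assumes G: "lca_group_on (UNIV :: 'a set)" and \<nu>: "haar_measure_on anti_diag \<nu>"
  shows "haar_measure_on UNIV (distr \<nu> borel fst)"
proof -
  define j :: "'a \<Rightarrow> 'a \<times> 'a" where "j = (\<lambda>x. (x, - x))"
  let ?l = "distr \<nu> borel fst"
  note fst_m = measurable_fst_anti_diag[OF \<nu>]
  note h = \<nu>[unfolded haar_measure_on_def]
  have space: "space \<nu> = anti_diag" using h by simp
  have vimage: "fst -` A \<inter> space \<nu> = j ` A" for A
    unfolding space j_def anti_diag_image by auto
  have meas: "j ` A \<in> sets \<nu>" if "A \<in> sets borel" for A
    using measurable_sets[OF fst_m that] by (simp only: vimage)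
  have em: "emeasure ?l A = emeasure \<nu> (j ` A)" if "A \<in> sets borel" for A
    using emeasure_distr[OF fst_m that] by (simp only: vimage)
  have j_compact: "compact (j ` K)" if "compact K" for K
    unfolding j_def using continuous_on_anti_diag_embedding[OF G] that by (rule compact_continuous_image)
  have j_anti_diag: "j ` A \<subseteq> anti_diag" for A by (auto simp: j_def anti_diag_def)
  have j_open: "openin (top_of_set anti_diag) (j ` U)" if "open U" for U
    using openin_anti_diag_image[OF G, of U] that unfolding j_def by blast
  \<comment> \<open>The first conjuncts of \<open>h1\<close>, \<open>h2\<close> and
    \<open>h3\<close> are invariance, finiteness on compact sets and positivity on open sets;
    \<open>h4\<close> holds outer and inner regularity.\<close>
  note h1 = h[THEN conjunct2, THEN conjunct2]
  note h2 = h1[THEN conjunct2]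
  note h3 = h2[THEN conjunct2]
  note h4 = h3[THEN conjunct2]
  show ?thesis
    unfolding haar_measure_on_def subtopology_UNIV open_openin[symmetric]
  proof (intro conjI ballI allI impI)
    show "space ?l = UNIV" by simp
    show "sets ?l = sets (restrict_space borel UNIV)" by (simp add: sets_restrict_space)
    show "emeasure ?l ((+) a ` A) = emeasure ?l A" if "A \<in> sets ?l" for a A
    proof -
      have A: "A \<in> sets borel" using that by simp
      have "(+) a ` A = (\<lambda>x. x + (- a)) -` A \<inter> space borel"
      proof (intro equalityI subsetI)
        fix x assume "x \<in> (\<lambda>x. x + (- a)) -` A \<inter> space borel"
        then show "x \<in> (+) a ` A" by (intro image_eqI[of _ _ "x - a"]) simp_all
      qed auto
      also have "\<dots> \<in> sets borel"
        using A by (intro measurable_sets[of _ borel borel] borel_measurable_continuous_onI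
            lca_group_continuous_add[OF G] continuous_on_id continuous_on_const)
      finally have aA: "(+) a ` A \<in> sets borel" .
      \<comment> \<open>As \<open>j\<close> is a homomorphism, translation by \<open>a\<close>
        corresponds to translation by \<open>j a\<close>.\<close>
      have "j ` (+) a ` A = (+) (j a) ` j ` A"
        by (simp add: image_image j_def)
      moreover have "j a \<in> anti_diag" by (auto simp: j_def anti_diag_def)
      ultimately show ?thesis
        using h1[THEN conjunct1] meas[OF A] by (simp only: em[OF A] em[OF aA])
    qed
    show "emeasure ?l K < \<infinity>" if "compact K \<and> K \<subseteq> UNIV" for K
      using h2[THEN conjunct1, rule_format, of "j ` K"] j_compact[of K] j_anti_diag that
      by (simp add: em borel_closed compact_imp_closed)
    show "emeasure ?l U > 0" if "open U \<and> U \<noteq> {}" for U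
      using h3[THEN conjunct1, rule_format, of "j ` U"] j_open[of U] that by (simp add: em)
    show "emeasure ?l A = (INF U\<in>{U. open U \<and> A \<subseteq> U}. emeasure ?l U)" if "A \<in> sets ?l" for A
    proof -
      have A: "A \<in> sets borel" using that by simp
      have "emeasure ?l A = (INF V\<in>{V. openin (top_of_set anti_diag) V \<and> j ` A \<subseteq> V}. emeasure \<nu> V)"
        using h4[THEN conjunct1] meas[OF A] by (simp only: em[OF A])
      also have "\<dots> = (INF U\<in>{U. open U \<and> A \<subseteq> U}. emeasure \<nu> (j ` U))"
        unfolding j_def openin_anti_diag_image[OF G] by (simp only: image_image)
      also have "\<dots> = (INF U\<in>{U. open U \<and> A \<subseteq> U}. emeasure ?l U)"
        by (intro INF_cong refl) (simp add: em)
      finally show ?thesis .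
    qed
    show "emeasure ?l U = (SUP K\<in>{K. compact K \<and> K \<subseteq> U}. emeasure ?l K)" if "open U" for U
    proof -
      have "emeasure ?l U = (SUP K\<in>{K. compact K \<and> K \<subseteq> j ` U}. emeasure \<nu> K)"
        using h4[THEN conjunct2] j_open[OF that] that by (simp add: em)
      also have "\<dots> = (SUP K\<in>{K. compact K \<and> K \<subseteq> U}. emeasure \<nu> (j ` K))"
        unfolding j_def compact_anti_diag_image[OF G] by (simp only: image_image)
      also have "\<dots> = (SUP K\<in>{K. compact K \<and> K \<subseteq> U}. emeasure ?l K)"
        by (intro SUP_cong refl) (simp add: em borel_closed compact_imp_closed)
      finally show ?thesis .
    qed
  qed
qed

section \<open>The isometric isomorphism of the two Beurling algebras\<close>

text \<open>The constant \<open>c\<close> is the one given by uniqueness of Haar measure; through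
  \<open>distr_eq\<close> every integral over \<nu> reduces to one over \<mu>.\<close>

locale anti_diag_haar =
  fixes \<mu> :: "'a::{t2_space, ab_group_add} measure" and \<nu> :: "('a \<times> 'a) measure" and c :: real
  assumes G: "lca_group_on (UNIV :: 'a set)"
    and \<mu>: "haar_measure_on UNIV \<mu>" and \<nu>: "haar_measure_on anti_diag \<nu>"
    and c_pos: "0 < c"
    and distr_eq: "distr \<nu> borel fst = density \<mu> (\<lambda>_. ennreal c)"
begin

lemma sets_\<mu> [measurable_cong]: "sets \<mu> = sets borel"
  by (rule haar_measure_on_UNIV_D(2)[OF \<mu>])

lemma space_\<nu>: "space \<nu> = anti_diag"
  using \<nu> by (simp add: haar_measure_on_def)

lemmas [measurable] = measurable_fst_anti_diag[OF \<nu>] measurable_anti_diag_embedding[OF G \<nu>]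

lemma
  fixes h :: "'a \<Rightarrow> 'b::{banach, second_countable_topology}"
  assumes [measurable]: "h \<in> borel_measurable borel"
  shows integrable_fst_iff: "integrable \<nu> (\<lambda>p. h (fst p)) \<longleftrightarrow> integrable \<mu> h"
    and integral_fst: "(\<integral>p. h (fst p) \<partial>\<nu>) = c *\<^sub>R (\<integral>x. h x \<partial>\<mu>)"
proof -
  have "integrable \<nu> (\<lambda>p. h (fst p)) \<longleftrightarrow> integrable (density \<mu> (\<lambda>_. ennreal c)) h"
    unfolding distr_eq[symmetric] by (rule integrable_distr_eq[symmetric]) measurable
  also have "\<dots> \<longleftrightarrow> integrable \<mu> h"
  proof
    assume "integrable (density \<mu> (\<lambda>_. ennreal c)) h"
    then have "integrable \<mu> (\<lambda>x. c *\<^sub>R h x)"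
      using c_pos by (subst (asm) integrable_density) auto
    then have "integrable \<mu> (\<lambda>x. (1 / c) *\<^sub>R (c *\<^sub>R h x))"
      by (rule integrable_scaleR_right)
    then show "integrable \<mu> h"
      using c_pos by (simp only: scaleR_scaleR) simp
  next
    assume "integrable \<mu> h"
    then show "integrable (density \<mu> (\<lambda>_. ennreal c)) h"
      using c_pos by (subst integrable_density) auto
  qed
  finally show "integrable \<nu> (\<lambda>p. h (fst p)) \<longleftrightarrow> integrable \<mu> h" .
  have "(\<integral>p. h (fst p) \<partial>\<nu>) = (\<integral>x. h x \<partial>density \<mu> (\<lambda>_. ennreal c))"
    unfolding distr_eq[symmetric] by (rule integral_distr[symmetric]) measurable
  also have "\<dots> = c *\<^sub>R (\<integral>x. h x \<partial>\<mu>)"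
    using c_pos by (subst integral_density) auto
  finally show "(\<integral>p. h (fst p) \<partial>\<nu>) = c *\<^sub>R (\<integral>x. h x \<partial>\<mu>)" .
qed

lemma
  fixes F :: "'a \<times> 'a \<Rightarrow> 'b::{banach, second_countable_topology}"
  assumes [measurable]: "F \<in> borel_measurable \<nu>"
  shows integrable_iff: "integrable \<nu> F \<longleftrightarrow> integrable \<mu> (\<lambda>x. F (x, - x))"
    and integral_eq: "(\<integral>p. F p \<partial>\<nu>) = c *\<^sub>R (\<integral>x. F (x, - x) \<partial>\<mu>)"
proof -
  have "F p = F (fst p, - fst p)" if "p \<in> space \<nu>" for p
    using that by (simp add: space_\<nu> anti_diag_eq)
  then have "integrable \<nu> F \<longleftrightarrow> integrable \<nu> (\<lambda>p. F (fst p, - fst p))"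
    "(\<integral>p. F p \<partial>\<nu>) = (\<integral>p. F (fst p, - fst p) \<partial>\<nu>)"
    by (auto intro!: Bochner_Integration.integrable_cong Bochner_Integration.integral_cong)
  then show "integrable \<nu> F \<longleftrightarrow> integrable \<mu> (\<lambda>x. F (x, - x))"
    "(\<integral>p. F p \<partial>\<nu>) = c *\<^sub>R (\<integral>x. F (x, - x) \<partial>\<mu>)"
    using integrable_fst_iff[of "\<lambda>x. F (x, - x)"] integral_fst[of "\<lambda>x. F (x, - x)"] by simp_all
qed

lemma measurable_diff [measurable]: "(\<lambda>y::'a. x - y) \<in> borel \<rightarrow>\<^sub>M borel"
  by (intro borel_measurable_continuous_onI lca_group_continuous_diff[OF G]
      continuous_on_id continuous_on_const)

text \<open>An integral over \<nu> is \<open>c\<close> times the corresponding integral over \<mu>.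
  The factor \<open>c\<close> therefore makes restriction isometric, and also multiplicative: the
  transformed convolution acquires a second \<open>c\<close> from its integral, matching the two
  scaled factors.\<close>

lemma L1w_isometric_hom_restrict:
  "L1w_isometric_hom \<nu> (weight_tensor \<omega>) \<mu> (weight_star \<omega>) (\<lambda>F x. complex_of_real c * F (x, - x))"
  unfolding L1w_isometric_hom_def
proof (intro conjI ballI allI)
  fix F assume "F \<in> L1w \<nu> (weight_tensor \<omega>)"
  then have F[measurable]: "F \<in> borel_measurable \<nu>"
    and int: "integrable \<nu> (\<lambda>p. cmod (F p) * weight_tensor \<omega> p)"
    by (auto simp: L1w_def)
  have m: "(\<lambda>p. cmod (F p) * weight_tensor \<omega> p) \<in> borel_measurable \<nu>"
    using int by (rule borel_measurable_integrable)
  have eq: "cmod (complex_of_real c * F (x, - x)) * weight_star \<omega> x =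
      c * (cmod (F (x, - x)) * weight_tensor \<omega> (x, - x))" for x
    using c_pos by (simp add: norm_mult weight_star_def weight_tensor_def)
  have "integrable \<mu> (\<lambda>x. cmod (F (x, - x)) * weight_tensor \<omega> (x, - x))"
    using int unfolding integrable_iff[OF m] .
  then show "(\<lambda>x. complex_of_real c * F (x, - x)) \<in> L1w \<mu> (weight_star \<omega>)"
    by (auto simp: L1w_def eq simp del: norm_mult)
  show "L1w_norm \<mu> (weight_star \<omega>) (\<lambda>x. complex_of_real c * F (x, - x)) =
      L1w_norm \<nu> (weight_tensor \<omega>) F"
    unfolding L1w_norm_def eq integral_eq[OF m] by simp
next
  fix F G assume "F \<in> L1w \<nu> (weight_tensor \<omega>)" "G \<in> L1w \<nu> (weight_tensor \<omega>)"
  then have [measurable]: "F \<in> borel_measurable \<nu>" "G \<in> borel_measurable \<nu>"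
    by (auto simp: L1w_def)
  show "(\<lambda>x. complex_of_real c * conv \<nu> F G (x, - x)) =
      conv \<mu> (\<lambda>x. complex_of_real c * F (x, - x)) (\<lambda>x. complex_of_real c * G (x, - x))"
  proof
    fix x
    have G_m: "(\<lambda>y. G (x - y, - (x - y))) \<in> borel_measurable borel"
      using measurable_compose[OF measurable_diff
          measurable_compose[OF measurable_anti_diag_embedding[OF G \<nu>] \<open>G \<in> borel_measurable \<nu>\<close>]] .
    \<comment> \<open>For \<open>p\<close> on the antidiagonal, \<open>(x, - x) - p\<close> lies
      there as well, so the integrand depends on \<open>fst p\<close> alone and the change of
      variables applies.\<close>
    have "conv \<nu> F G (x, - x) = (\<integral>p. F (fst p, - fst p) * G (x - fst p, - (x - fst p)) \<partial>\<nu>)"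
      unfolding conv_def
    proof (rule Bochner_Integration.integral_cong[OF refl])
      fix p assume "p \<in> space \<nu>"
      then obtain y where "p = (y, - y)" by (auto simp: space_\<nu> anti_diag_def)
      then show "F p * G ((x, - x) - p) = F (fst p, - fst p) * G (x - fst p, - (x - fst p))"
        by simp
    qed
    also have "\<dots> = c *\<^sub>R (\<integral>y. F (y, - y) * G (x - y, - (x - y)) \<partial>\<mu>)"
      by (rule integral_fst[of "\<lambda>y. F (y, - y) * G (x - y, - (x - y))"])
        (intro borel_measurable_times G_m, measurable)
    finally show "complex_of_real c * conv \<nu> F G (x, - x) =
        conv \<mu> (\<lambda>x. complex_of_real c * F (x, - x)) (\<lambda>x. complex_of_real c * G (x, - x)) x"
      by (simp add: conv_def scaleR_conv_of_real mult_ac)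
  qed
next
  fix F G :: "'a \<times> 'a \<Rightarrow> complex" and k :: complex
  show "(\<lambda>x. complex_of_real c * (F (x, - x) + G (x, - x))) =
      (\<lambda>x. complex_of_real c * F (x, - x) + complex_of_real c * G (x, - x))"
    by (simp only: distrib_left)
  show "(\<lambda>x. complex_of_real c * (k * F (x, - x))) = (\<lambda>x. k * (complex_of_real c * F (x, - x)))"
    by (simp only: mult.left_commute)
qed

lemma L1w_isometric_hom_extend:
  "L1w_isometric_hom \<mu> (weight_star \<omega>) \<nu> (weight_tensor \<omega>) (\<lambda>f p. f (fst p) / complex_of_real c)"
  unfolding L1w_isometric_hom_def
proof (intro conjI ballI allI)
  fix f assume "f \<in> L1w \<mu> (weight_star \<omega>)"
  then have f[measurable]: "f \<in> borel_measurable borel"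
    and int: "integrable \<mu> (\<lambda>x. cmod (f x) * weight_star \<omega> x)"
    by (auto simp: L1w_def measurable_cong_sets[OF sets_\<mu> refl])
  have m: "(\<lambda>x. cmod (f x) * weight_star \<omega> x) \<in> borel_measurable borel"
    using borel_measurable_integrable[OF int] by (simp add: measurable_cong_sets[OF sets_\<mu> refl])
  have eq: "cmod (f (fst p) / complex_of_real c) * weight_tensor \<omega> p =
      cmod (f (fst p)) * weight_star \<omega> (fst p) / c" if "p \<in> space \<nu>" for p
  proof -
    obtain y where "p = (y, - y)" using \<open>p \<in> space \<nu>\<close> by (auto simp: space_\<nu> anti_diag_def)
    then show ?thesis using c_pos by (simp add: norm_divide weight_star_def weight_tensor_def)
  qed
  have "integrable \<nu> (\<lambda>p. cmod (f (fst p)) * weight_star \<omega> (fst p))"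
    using int integrable_fst_iff[OF m] by simp
  then have "integrable \<nu> (\<lambda>p. cmod (f (fst p) / complex_of_real c) * weight_tensor \<omega> p)"
    by (subst Bochner_Integration.integrable_cong[OF refl eq]) auto
  moreover have "(\<lambda>p. f (fst p) / complex_of_real c) \<in> borel_measurable \<nu>" by measurable
  ultimately show "(\<lambda>p. f (fst p) / complex_of_real c) \<in> L1w \<nu> (weight_tensor \<omega>)"
    by (simp add: L1w_def)
  have "L1w_norm \<nu> (weight_tensor \<omega>) (\<lambda>p. f (fst p) / complex_of_real c) =
      (\<integral>p. cmod (f (fst p)) * weight_star \<omega> (fst p) / c \<partial>\<nu>)"
    unfolding L1w_norm_def using eq by (intro Bochner_Integration.integral_cong) auto
  also have "\<dots> = L1w_norm \<mu> (weight_star \<omega>) f"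
    using integral_fst[OF m] c_pos by (simp add: L1w_norm_def)
  finally show "L1w_norm \<nu> (weight_tensor \<omega>) (\<lambda>p. f (fst p) / complex_of_real c) =
      L1w_norm \<mu> (weight_star \<omega>) f" .
next
  fix f g assume "f \<in> L1w \<mu> (weight_star \<omega>)" "g \<in> L1w \<mu> (weight_star \<omega>)"
  then have [measurable]: "f \<in> borel_measurable borel" "g \<in> borel_measurable borel"
    by (auto simp: L1w_def measurable_cong_sets[OF sets_\<mu> refl])
  show "(\<lambda>p. conv \<mu> f g (fst p) / complex_of_real c) =
      conv \<nu> (\<lambda>p. f (fst p) / complex_of_real c) (\<lambda>p. g (fst p) / complex_of_real c)"
  proof
    \<comment> \<open>The equation is needed at every \<open>p\<close>, also off the antidiagonal;
      it holds because both sides depend on \<open>p\<close> only through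
      \<open>fst p\<close>.\<close>
    fix p :: "'a \<times> 'a"
    have "(\<integral>q. f (fst q) * g (fst p - fst q) \<partial>\<nu>) = c *\<^sub>R conv \<mu> f g (fst p)"
      unfolding conv_def by (rule integral_fst[of "\<lambda>y. f y * g (fst p - y)"]) measurable
    then show "conv \<mu> f g (fst p) / complex_of_real c =
        conv \<nu> (\<lambda>p. f (fst p) / complex_of_real c) (\<lambda>p. g (fst p) / complex_of_real c) p"
      using c_pos by (simp add: conv_def scaleR_conv_of_real)
  qed
next
  fix f g :: "'a \<Rightarrow> complex" and k :: complex
  show "(\<lambda>p. (f (fst p) + g (fst p)) / complex_of_real c) =
      (\<lambda>p. f (fst p) / complex_of_real c + g (fst p) / complex_of_real c)"
    by (simp only: add_divide_distrib)
  show "(\<lambda>p. k * f (fst p) / complex_of_real c) = (\<lambda>p. k * (f (fst p) / complex_of_real c))"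
    by (simp only: times_divide_eq_right)
qed

lemma weakly_amenable_L1_anti_diag_iff:
  "weakly_amenable_L1 \<mu> (weight_star \<omega>) \<longleftrightarrow> weakly_amenable_L1 \<nu> (weight_tensor \<omega>)"
proof
  assume "weakly_amenable_L1 \<mu> (weight_star \<omega>)"
  then show "weakly_amenable_L1 \<nu> (weight_tensor \<omega>)"
  proof (rule weakly_amenable_L1_transfer[OF L1w_isometric_hom_restrict L1w_isometric_hom_extend, rotated])
    show "complex_of_real c * f (fst p, - fst p) / complex_of_real c = f p"
      if "p \<in> space \<nu>" for f :: "'a \<times> 'a \<Rightarrow> complex" and p
      using that c_pos by (simp add: space_\<nu> anti_diag_eq)
  qed
next
  assume "weakly_amenable_L1 \<nu> (weight_tensor \<omega>)"
  then show "weakly_amenable_L1 \<mu> (weight_star \<omega>)"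
    using c_pos
    by (intro weakly_amenable_L1_transfer[OF L1w_isometric_hom_extend L1w_isometric_hom_restrict]) auto
qed

end

theorem theorem3p9:
  fixes \<omega> :: "'a::{t2_space, ab_group_add} \<Rightarrow> real"
    and \<mu> :: "'a measure"
    and \<nu> :: "('a \<times> 'a) measure"
  assumes "lca_group_on (UNIV :: 'a set)"
    and "weight_on UNIV \<omega>"
    and "haar_measure_on UNIV \<mu>"
    and "haar_measure_on anti_diag \<nu>"
  shows "weakly_amenable_L1 \<mu> (weight_star \<omega>) \<longleftrightarrow>
         weakly_amenable_L1 \<nu> (\<lambda>p. weight_tensor \<omega> p)"
proof -
  obtain c :: real where "0 < c" "distr \<nu> borel fst = density \<mu> (\<lambda>_. ennreal c)"
    using haar_measure_unique[OF assms(1,3) haar_measure_on_distr_fst[OF assms(1,4)]] .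
  then interpret anti_diag_haar \<mu> \<nu> c
    using assms by unfold_locales
  show ?thesis by (rule weakly_amenable_L1_anti_diag_iff)
qed

end
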